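(* Suppose that for some $c>0$ and $\varepsilon>0$ and for every $k\ge 2$ there is a fine-grained reduction from solving $k$-SAT in time $\mathrm{poly}(n,m)\,2^n/2^{\varepsilon n}$ to solving LCS in time $O(N^2/\log^c N)$, i.e., an algorithm $X$ solving $k$-SAT on $n$ variables and $m$ clauses using an oracle for LCS, making calls on LCS instances of sizes $N_1,\dots,N_t$, such that $T_X(n)+\sum_{i=1}^t N_i^2/\log^c N_i = O(\mathrm{poly}(n,m)\,2^n/2^{\varepsilon n})$, where $T_X(n)$ is the running time of $X$ excluding oracle calls. Then SETH is false.
   Context: $k$-SAT: given a CNF formula with $n$ variables and $m$ clauses, each clause having at most $k$ literals, decide satisfiability. LCS: given two strings of length $N$, compute the length of their longest common subsequence. The Strong Exponential Time Hypothesis (SETH): for every $\varepsilon>0$ there is $k\ge 2$ such that $k$-SAT cannot be solved in time $\mathrm{poly}(n,m)\,2^{(1-\varepsilon)n}$. Running times are non-decreasing functions. *)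

theory Defs
  imports Complex_Main "HOL-Library.Sublist"
begin

subsection \<open>k-SAT and LCS\<close>

datatype lit = Pos nat | Neg nat

type_synonym clause = "lit list"
type_synonym cnf = "clause list"

fun var_of :: "lit \<Rightarrow> nat" where
  "var_of (Pos v) = v"
| "var_of (Neg v) = v"

fun lit_true :: "(nat \<Rightarrow> bool) \<Rightarrow> lit \<Rightarrow> bool" where
  "lit_true \<sigma> (Pos v) \<longleftrightarrow> \<sigma> v"
| "lit_true \<sigma> (Neg v) \<longleftrightarrow> \<not> \<sigma> v"

definition satisfiable :: "cnf \<Rightarrow> bool" where
  "satisfiable \<phi> \<longleftrightarrow> (\<exists>\<sigma>. \<forall>C\<in>set \<phi>. \<exists>l\<in>set C. lit_true \<sigma> l)"

text \<open>The variables are \<open>0, \<dots>, n - 1\<close>; they need not all occur in the formula.\<close>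

definition is_kcnf :: "nat \<Rightarrow> nat \<Rightarrow> cnf \<Rightarrow> bool" where
  "is_kcnf k n \<phi> \<longleftrightarrow> (\<forall>C\<in>set \<phi>. length C \<le> k \<and> (\<forall>l\<in>set C. var_of l < n))"

definition lcs_length :: "'a list \<Rightarrow> 'a list \<Rightarrow> nat" where
  "lcs_length xs ys = Max {length zs | zs. subseq zs xs \<and> subseq zs ys}"

subsection \<open>Word RAM programs with access to LCS\<close>

text \<open>
  The machine is a structured, deterministic, unit-cost word RAM with words of \<open>w\<close> bits. A program
  uses finitely many registers and finitely many random access arrays, both named by natural
  numbers; all arrays are indexed by words and contain words. The command \<open>Query r a b l\<close> reads the
  length \<open>N\<close> from register \<open>l\<close> and writes into register \<open>r\<close> the length of a longest common
  subsequence of the two strings of \<open>N\<close> words stored in the first \<open>N\<close> cells of the arrays \<open>a\<close>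
  and \<open>b\<close>.
\<close>

type_synonym state = "(nat \<Rightarrow> nat) \<times> (nat \<Rightarrow> nat \<Rightarrow> nat)"

datatype binop = Add | Sub | Mul | Div | Mod | And | Or | Xor | Shl | Shr | Less | Equal

datatype com =
    Skip
  | Const nat nat             \<comment> \<open>target register, constant\<close>
  | Op binop nat nat nat      \<comment> \<open>operation, target register, two operand registers\<close>
  | Load nat nat nat          \<comment> \<open>target register, array, index register\<close>
  | Store nat nat nat         \<comment> \<open>array, index register, source register\<close>
  | Query nat nat nat nat
  | Seq com com
  | Cond nat com com          \<comment> \<open>the first branch is taken if the register is nonzero\<close>
  | While nat com             \<comment> \<open>loop as long as the register is nonzero\<close>

fun query_free :: "com \<Rightarrow> bool" where
  "query_free (Query r a b l) \<longleftrightarrow> False"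
| "query_free (Seq p q) \<longleftrightarrow> query_free p \<and> query_free q"
| "query_free (Cond r p q) \<longleftrightarrow> query_free p \<and> query_free q"
| "query_free (While r p) \<longleftrightarrow> query_free p"
| "query_free _ \<longleftrightarrow> True"

unbundle bit_operations_syntax

text \<open>Subtraction is modulo \<open>2 ^ w\<close>, like addition; its second operand is a word.\<close>

fun op_val :: "nat \<Rightarrow> binop \<Rightarrow> nat \<Rightarrow> nat \<Rightarrow> nat" where
  "op_val w Add x y = (x + y) mod 2 ^ w"
| "op_val w Sub x y = (x + 2 ^ w - y) mod 2 ^ w"
| "op_val w Mul x y = (x * y) mod 2 ^ w"
| "op_val w Div x y = (x div y) mod 2 ^ w"
| "op_val w Mod x y = (x mod y) mod 2 ^ w"
| "op_val w And x y = (x AND y) mod 2 ^ w"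
| "op_val w Or x y = (x OR y) mod 2 ^ w"
| "op_val w Xor x y = (x XOR y) mod 2 ^ w"
| "op_val w Shl x y = (x * 2 ^ y) mod 2 ^ w"
| "op_val w Shr x y = (x div 2 ^ y) mod 2 ^ w"
| "op_val w Less x y = (if x < y then 1 else 0) mod 2 ^ w"
| "op_val w Equal x y = (if x = y then 1 else 0) mod 2 ^ w"

unbundle no bit_operations_syntax

text \<open>
  \<open>exec w p s t Ns s'\<close>: with word size \<open>w\<close>, the program \<open>p\<close> started in \<open>s\<close> terminates in \<open>s'\<close>
  after \<open>t\<close> steps, and \<open>Ns\<close> lists the sizes of the LCS instances queried on the way. A query
  contributes a single step to \<open>t\<close>; the time for answering it is not included in \<open>t\<close>.
\<close>

inductive exec :: "nat \<Rightarrow> com \<Rightarrow> state \<Rightarrow> nat \<Rightarrow> nat list \<Rightarrow> state \<Rightarrow> bool" for w where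
  Skip: "exec w Skip s 1 [] s"
| Const: "exec w (Const r v) (R, M) 1 [] (R(r := v mod 2 ^ w), M)"
| Op: "exec w (Op f r x y) (R, M) 1 [] (R(r := op_val w f (R x) (R y)), M)"
| Load: "exec w (Load r a i) (R, M) 1 [] (R(r := M a (R i)), M)"
| Store: "exec w (Store a i r) (R, M) 1 [] (R, M(a := (M a)(R i := R r)))"
| Query: "exec w (Query r a b l) (R, M) 1 [R l]
    (R(r := lcs_length (map (M a) [0..<R l]) (map (M b) [0..<R l])), M)"
| Seq: "exec w p s t Ns s' \<Longrightarrow> exec w q s' t' Ns' s'' \<Longrightarrow> exec w (Seq p q) s (t + t') (Ns @ Ns') s''"
| CondTrue: "R r \<noteq> 0 \<Longrightarrow> exec w p (R, M) t Ns s' \<Longrightarrow> exec w (Cond r p q) (R, M) (t + 1) Ns s'"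
| CondFalse: "R r = 0 \<Longrightarrow> exec w q (R, M) t Ns s' \<Longrightarrow> exec w (Cond r p q) (R, M) (t + 1) Ns s'"
| WhileFalse: "R r = 0 \<Longrightarrow> exec w (While r p) (R, M) 1 [] (R, M)"
| WhileTrue: "R r \<noteq> 0 \<Longrightarrow> exec w p (R, M) t Ns s' \<Longrightarrow> exec w (While r p) s' t' Ns' s'' \<Longrightarrow>
    exec w (While r p) (R, M) (t + t' + 1) (Ns @ Ns') s''"

inductive_cases exec_elims [elim!]:
  "exec w Skip s t Ns s'"
  "exec w (Const r v) s t Ns s'"
  "exec w (Op f r x y) s t Ns s'"
  "exec w (Load r a i) s t Ns s'"
  "exec w (Store a i r) s t Ns s'"
  "exec w (Query r a b l) s t Ns s'"
  "exec w (Seq p q) s t Ns s'"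
  "exec w (Cond r p q) s t Ns s'"

inductive_cases exec_WhileE: "exec w (While r p) s t Ns s'"

lemma exec_deterministic:
  "exec w p s t Ns s' \<Longrightarrow> exec w p s u Ms s'' \<Longrightarrow> t = u \<and> Ns = Ms \<and> s' = s''"
proof (induction arbitrary: u Ms s'' rule: exec.induct)
  case (Seq p s t Ns s' q t' Ns' s'')
  then show ?case by (metis exec_elims(7))
next
  case (WhileFalse R r p M)
  then show ?case by (auto elim: exec_WhileE)
next
  case (WhileTrue R r p M t Ns s' t' Ns' s3)
  from WhileTrue.prems WhileTrue.hyps obtain t1 Ns1 s1 t2 Ns2
    where *: "u = t1 + t2 + 1" "Ms = Ns1 @ Ns2"
      "exec w p (R, M) t1 Ns1 s1" "exec w (While r p) s1 t2 Ns2 s''"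
    by (cases rule: exec_WhileE) auto
  then have "t = t1 \<and> Ns = Ns1 \<and> s' = s1" using WhileTrue.IH(1) by blast
  moreover from this * have "t' = t2 \<and> Ns' = Ns2 \<and> s3 = s''" using WhileTrue.IH(2) by blast
  ultimately show ?case using * by simp
next
  case (CondTrue R r p M t Ns s' q)
  from CondTrue.prems CondTrue.hyps obtain u' where "exec w p (R, M) u' Ms s''" "u = u' + 1"
    by auto
  with CondTrue.IH show ?case by blast
next
  case (CondFalse R r q M t Ns s' p)
  from CondFalse.prems CondFalse.hyps obtain u' where "exec w q (R, M) u' Ms s''" "u = u' + 1"
    by auto
  with CondFalse.IH show ?case by blast
qed auto

subsection \<open>Running k-SAT algorithms\<close>

fun lit_code :: "lit \<Rightarrow> nat" where
  "lit_code (Pos v) = 2 * v"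
| "lit_code (Neg v) = 2 * v + 1"

definition encode :: "nat \<Rightarrow> cnf \<Rightarrow> nat list" where
  "encode n \<phi> = n # length \<phi> # concat (map (\<lambda>C. length C # map lit_code C) \<phi>)"

text \<open>The input is stored in array 0; all other cells and all registers are 0.\<close>

definition init_state :: "nat list \<Rightarrow> state" where
  "init_state xs = ((\<lambda>_. 0), (\<lambda>a i. if a = 0 \<and> i < length xs then xs ! i else 0))"

text \<open>
  As usual for exponential time algorithms, words have \<open>\<Theta>(n + log m)\<close> bits. The constant factor
  belongs to the algorithm; it has to be chosen such that the input fits, i.e. all its entries and
  all its addresses are words.
\<close>

definition word_size :: "nat \<Rightarrow> nat \<Rightarrow> nat \<Rightarrow> nat" where
  "word_size \<gamma> n m = \<gamma> * (n + nat \<lceil>log 2 (real m + 2)\<rceil>)"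

definition input_fits :: "nat \<Rightarrow> nat \<Rightarrow> cnf \<Rightarrow> bool" where
  "input_fits \<gamma> n \<phi> \<longleftrightarrow> (let xs = encode n \<phi>; w = word_size \<gamma> n (length \<phi>)
     in length xs < 2 ^ w \<and> (\<forall>x\<in>set xs. x < 2 ^ w))"

text \<open>A program accepts by terminating with a nonzero value in register 0.\<close>

definition correct_run :: "com \<Rightarrow> nat \<Rightarrow> nat \<Rightarrow> cnf \<Rightarrow> nat \<Rightarrow> nat list \<Rightarrow> bool" where
  "correct_run X \<gamma> n \<phi> t Ns \<longleftrightarrow>
     (\<exists>R M. exec (word_size \<gamma> n (length \<phi>)) X (init_state (encode n \<phi>)) t Ns (R, M) \<and>
        (R 0 \<noteq> 0 \<longleftrightarrow> satisfiable \<phi>))"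

text \<open>Running times depend on the number \<open>n\<close> of variables and the number \<open>m\<close> of clauses.\<close>

definition running_time :: "(nat \<Rightarrow> nat \<Rightarrow> real) \<Rightarrow> bool" where
  "running_time T \<longleftrightarrow> (\<forall>n n' m m'. n \<le> n' \<longrightarrow> m \<le> m' \<longrightarrow> T n m \<le> T n' m')"

text \<open>The functions bounded by \<open>poly(n, m) \<cdot> g(n)\<close>.\<close>

definition poly_times :: "(nat \<Rightarrow> real) \<Rightarrow> (nat \<Rightarrow> nat \<Rightarrow> real) set" where
  "poly_times g = {T. \<exists>C::real. \<exists>d::nat. \<forall>n m. T n m \<le> C * (real n + real m + 1) ^ d * g n}"

definition ksat_solvable_in :: "nat \<Rightarrow> (nat \<Rightarrow> nat \<Rightarrow> real) \<Rightarrow> bool" where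
  "ksat_solvable_in k T \<longleftrightarrow>
     (\<exists>X \<gamma>. query_free X \<and>
       (\<forall>n \<phi>. is_kcnf k n \<phi> \<longrightarrow> input_fits \<gamma> n \<phi> \<and>
          (\<exists>t. correct_run X \<gamma> n \<phi> t [] \<and> real t \<le> T n (length \<phi>))))"

definition SETH :: bool where
  "SETH \<longleftrightarrow> (\<forall>\<epsilon>::real>0. \<exists>k\<ge>2. \<not> (\<exists>T. running_time T \<and>
     T \<in> poly_times (\<lambda>n. 2 powr ((1 - \<epsilon>) * real n)) \<and> ksat_solvable_in k T))"

text \<open>\<open>N\<^sup>2 / log\<^sup>c N\<close>; the maximum only avoids logarithms below 1 in case \<open>N < 2\<close>.\<close>

definition lcs_time :: "real \<Rightarrow> nat \<Rightarrow> real" where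
  "lcs_time c N = (real N)\<^sup>2 / log 2 (real (max 2 N)) powr c"

text \<open>
  A fine-grained reduction from solving k-SAT in time \<open>poly(n, m) 2\<^sup>n / 2 powr (\<epsilon> n)\<close> to solving LCS
  in time \<open>O(N\<^sup>2 / log\<^sup>c N)\<close>. \<open>T\<close> is the running time of \<open>X\<close> excluding the LCS calls, whose
  sizes are listed in \<open>Ns\<close>; the constant of the O-notation is part of \<open>poly_times\<close>.
\<close>

definition ksat_to_lcs_reduction :: "nat \<Rightarrow> real \<Rightarrow> real \<Rightarrow> bool" where
  "ksat_to_lcs_reduction k \<epsilon> c \<longleftrightarrow>
     (\<exists>X \<gamma> T B. running_time T \<and>
       B \<in> poly_times (\<lambda>n. 2 ^ n / 2 powr (\<epsilon> * real n)) \<and>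
       (\<forall>n \<phi>. is_kcnf k n \<phi> \<longrightarrow> input_fits \<gamma> n \<phi> \<and>
          (\<exists>t Ns. correct_run X \<gamma> n \<phi> t Ns \<and> real t \<le> T n (length \<phi>) \<and>
             T n (length \<phi>) + (\<Sum>N\<leftarrow>Ns. lcs_time c N) \<le> B n (length \<phi>))))"

end

theory Submission
  imports Defs "HOL-Library.Infinite_Set"
begin

text \<open>
  Every LCS call is replaced by the textbook quadratic dynamic program. Since a query size is a
  machine word, \<open>log N\<close> is at most the word size, which is linear in \<open>n + log m\<close>. Hence
  \<open>log\<^sup>c N\<close> is bounded by a polynomial in \<open>n\<close> and \<open>m\<close>, and the difference between \<open>N\<^sup>2\<close>
  and \<open>N\<^sup>2 / log\<^sup>c N\<close> is absorbed by the factor \<open>poly(n, m)\<close>.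
\<close>

subsection \<open>Longest common subsequences\<close>

lemma finite_common_subseq_lengths: "finite {length zs | zs. subseq zs xs \<and> subseq zs ys}"
  by (rule finite_subset[of _ "{..length xs}"]) (auto dest: list_emb_length)

lemma length_le_lcs_length:
  "subseq zs xs \<Longrightarrow> subseq zs ys \<Longrightarrow> length zs \<le> lcs_length xs ys"
  unfolding lcs_length_def by (rule Max_ge[OF finite_common_subseq_lengths]) auto

lemma lcs_length_witness:
  obtains zs where "subseq zs xs" "subseq zs ys" "length zs = lcs_length xs ys"
proof -
  have "lcs_length xs ys \<in> {length zs | zs. subseq zs xs \<and> subseq zs ys}"
    unfolding lcs_length_def
    by (rule Max_in[OF finite_common_subseq_lengths]) (auto intro: exI[of _ "[]"])
  then show ?thesis using that by auto
qed

lemma lcs_length_le: "lcs_length xs ys \<le> length xs"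
  by (metis lcs_length_witness list_emb_length)

lemma lcs_length_Nil [simp]: "lcs_length [] ys = 0" "lcs_length xs [] = 0"
proof -
  show "lcs_length [] ys = 0" using lcs_length_le[of "[]" ys] by simp
  show "lcs_length xs [] = 0"
    by (rule lcs_length_witness[of xs "[]"]) (auto dest: list_emb_length)
qed

text \<open>Dropping the first entry of a common subsequence leaves a common subsequence of the
  tails, and conversely \<open>x\<close> can be put in front of any of these.\<close>

lemma lcs_length_Cons_same: "lcs_length (x # xs) (x # ys) = Suc (lcs_length xs ys)"
proof (rule antisym)
  obtain zs where zs: "subseq zs (x # xs)" "subseq zs (x # ys)"
      "length zs = lcs_length (x # xs) (x # ys)"
    by (rule lcs_length_witness)
  show "lcs_length (x # xs) (x # ys) \<le> Suc (lcs_length xs ys)"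
  proof (cases zs)
    case (Cons z us)
    then have "subseq us xs" "subseq us ys"
      using zs subseq_Cons' by (metis subseq_Cons2_iff)+
    then show ?thesis using length_le_lcs_length[of us xs ys] zs Cons by simp
  qed (use zs in simp)
next
  obtain zs where zs: "subseq zs xs" "subseq zs ys" "length zs = lcs_length xs ys"
    by (rule lcs_length_witness)
  then show "Suc (lcs_length xs ys) \<le> lcs_length (x # xs) (x # ys)"
    using length_le_lcs_length[of "x # zs" "x # xs" "x # ys"] by simp
qed

lemma lcs_length_Cons_diff:
  assumes "x \<noteq> y"
  shows "lcs_length (x # xs) (y # ys) = max (lcs_length xs (y # ys)) (lcs_length (x # xs) ys)"
proof (rule antisym)
  obtain zs where zs: "subseq zs (x # xs)" "subseq zs (y # ys)"
      "length zs = lcs_length (x # xs) (y # ys)"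
    by (rule lcs_length_witness)
  show "lcs_length (x # xs) (y # ys) \<le> max (lcs_length xs (y # ys)) (lcs_length (x # xs) ys)"
  proof (cases zs)
    case (Cons z us)
    then have "subseq zs xs \<or> subseq zs ys"
      using zs assms by (metis subseq_Cons2_neq)
    then show ?thesis
      using length_le_lcs_length[of zs xs "y # ys"] length_le_lcs_length[of zs "x # xs" ys] zs
      by auto
  qed (use zs in simp)
next
  have "lcs_length xs (y # ys) \<le> lcs_length (x # xs) (y # ys)"
    by (metis lcs_length_witness length_le_lcs_length list_emb_Cons)
  moreover have "lcs_length (x # xs) ys \<le> lcs_length (x # xs) (y # ys)"
    by (metis lcs_length_witness length_le_lcs_length list_emb_Cons)
  ultimately show
    "max (lcs_length xs (y # ys)) (lcs_length (x # xs) ys) \<le> lcs_length (x # xs) (y # ys)"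
    by simp
qed

subsection \<open>Weakest preconditions of query-free runs\<close>

text \<open>This is total correctness: as \<open>exec\<close> is deterministic, the run whose
  existence is claimed is the only one. The postcondition also sees the step count, so time bounds
  compose along with the functional ones.\<close>

definition wp :: "nat \<Rightarrow> com \<Rightarrow> state \<Rightarrow> (nat \<Rightarrow> state \<Rightarrow> bool) \<Rightarrow> bool" where
  "wp w p s Q \<longleftrightarrow> (\<exists>t s'. exec w p s t [] s' \<and> Q t s')"

lemma wp_mono: "wp w p s Q \<Longrightarrow> (\<And>t s'. Q t s' \<Longrightarrow> Q' t s') \<Longrightarrow> wp w p s Q'"
  unfolding wp_def by blast

lemma wp_simps [simp]:
  "wp w Skip (R, M) Q \<longleftrightarrow> Q 1 (R, M)"
  "wp w (Const r v) (R, M) Q \<longleftrightarrow> Q 1 (R(r := v mod 2 ^ w), M)"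
  "wp w (Op f r x y) (R, M) Q \<longleftrightarrow> Q 1 (R(r := op_val w f (R x) (R y)), M)"
  "wp w (Load r a i) (R, M) Q \<longleftrightarrow> Q 1 (R(r := M a (R i)), M)"
  "wp w (Store a i r) (R, M) Q \<longleftrightarrow> Q 1 (R, M(a := (M a)(R i := R r)))"
  unfolding wp_def by safe (simp, blast intro: exec.intros)+

lemma wp_Seq [simp]:
  "wp w (Seq p q) s Q \<longleftrightarrow> wp w p s (\<lambda>t s'. wp w q s' (\<lambda>t' s''. Q (t + t') s''))"
  unfolding wp_def
proof safe
  fix t s' t' s''
  assume "exec w p s t [] s'" "exec w q s' t' [] s''" "Q (t + t') s''"
  then show "\<exists>t s'. exec w (Seq p q) s t [] s' \<and> Q t s'"
    using exec.Seq[of w p s t "[]" s' q t' "[]" s''] by (metis append_Nil)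
qed blast

lemma wp_Cond [simp]:
  "wp w (Cond r p q) (R, M) Q \<longleftrightarrow>
     (if R r \<noteq> 0 then wp w p (R, M) (\<lambda>t. Q (t + 1)) else wp w q (R, M) (\<lambda>t. Q (t + 1)))"
  unfolding wp_def using exec.CondTrue[of R r w p M] exec.CondFalse[of R r w q M]
  by auto metis+

text \<open>The invariant is indexed by the number of iterations still to come, which suits loops
  that count down. Each iteration costs at most \<open>K\<close> steps plus one for the test, and
  the last \<open>1\<close> is the failing test.\<close>

lemma wp_While:
  assumes step: "\<And>i R M. i < n \<Longrightarrow> Inv (Suc i) R M \<Longrightarrow>
      R r \<noteq> 0 \<and> wp w p (R, M) (\<lambda>t s. t \<le> K \<and> (case s of (R', M') \<Rightarrow> Inv i R' M'))"
    and base: "\<And>R M. Inv 0 R M \<Longrightarrow> R r = 0"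
    and init: "Inv n R M"
    and post: "\<And>t R' M'. t \<le> (K + 1) * n + 1 \<Longrightarrow> Inv 0 R' M' \<Longrightarrow> Q t (R', M')"
  shows "wp w (While r p) (R, M) Q"
proof -
  have "wp w (While r p) (R, M) (\<lambda>t s. t \<le> (K + 1) * n + 1 \<and> (case s of (R', M') \<Rightarrow> Inv 0 R' M'))"
    using init step
  proof (induction n arbitrary: R M)
    case 0
    then show ?case
      unfolding wp_def using base exec.WhileFalse[of R r w p M] by force
  next
    case (Suc n)
    obtain t R1 M1 where 1: "exec w p (R, M) t [] (R1, M1)" "t \<le> K" "Inv n R1 M1" "R r \<noteq> 0"
      using Suc.prems(2)[of n R M] Suc.prems(1) unfolding wp_def by auto
    have step': "R r \<noteq> 0 \<and> wp w p (R, M) (\<lambda>t s. t \<le> K \<and> (case s of (R', M') \<Rightarrow> Inv i R' M'))"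
      if "i < n" "Inv (Suc i) R M" for i R M
      by (rule Suc.prems(2)) (use that in simp_all)
    obtain t' R2 M2 where 2: "exec w (While r p) (R1, M1) t' [] (R2, M2)"
        "t' \<le> (K + 1) * n + 1" "Inv 0 R2 M2"
      using Suc.IH[OF 1(3) step'] unfolding wp_def by auto
    have "exec w (While r p) (R, M) (t + t' + 1) [] (R2, M2)"
      using exec.WhileTrue[OF 1(4,1) 2(1)] by simp
    moreover have "t + t' + 1 \<le> (K + 1) * Suc n + 1"
      using 1(2) 2(2) by simp
    ultimately show ?case unfolding wp_def using 2(3) by blast
  qed
  then show ?thesis by (rule wp_mono) (auto intro: post)
qed

subsection \<open>The quadratic algorithm\<close>

text \<open>
  Registers from \<open>q\<close> on and array \<open>d\<close> are scratch space. Both loops run downwards, such that the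
  table entry for \<open>(i, j)\<close> belongs to the suffixes starting at \<open>i\<close> and \<open>j\<close>; a single row is kept.
  When column \<open>j\<close> is entered, the registers \<open>q + 5\<close> and \<open>q + 6\<close> contain the entries for
  \<open>(i + 1, j + 1)\<close> and \<open>(i, j + 1)\<close>. \<open>Op And x y y\<close> copies \<open>y\<close> to \<open>x\<close>.
\<close>

definition lcs_clear_body :: "nat \<Rightarrow> nat \<Rightarrow> com" where
  "lcs_clear_body q d = Seq (Op Sub (q+2) (q+2) q) (Store d (q+2) (q+6))"

text \<open>Registers \<open>q+3\<close> and \<open>q+4\<close> hold the two letters to compare.
  Register \<open>q+7\<close> saves the entry for \<open>(i + 1, j)\<close> before its cell is
  overwritten; it then moves to \<open>q+5\<close>, being the diagonal neighbour of the next
  column.\<close>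

definition lcs_inner_body :: "nat \<Rightarrow> nat \<Rightarrow> nat \<Rightarrow> com" where
  "lcs_inner_body q d b =
     Seq (Op Sub (q+2) (q+2) q)
    (Seq (Load (q+4) b (q+2))
    (Seq (Load (q+7) d (q+2))
    (Seq (Op Equal (q+8) (q+3) (q+4))
    (Seq (Cond (q+8)
            (Op Add (q+6) (q+5) q)
            (Seq (Op Less (q+8) (q+6) (q+7))
                 (Cond (q+8) (Op And (q+6) (q+7) (q+7)) Skip)))
    (Seq (Store d (q+2) (q+6))
         (Op And (q+5) (q+7) (q+7)))))))"

definition lcs_outer_body :: "nat \<Rightarrow> nat \<Rightarrow> nat \<Rightarrow> nat \<Rightarrow> nat \<Rightarrow> com" where
  "lcs_outer_body q d a b l =
     Seq (Op Sub (q+1) (q+1) q)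
    (Seq (Load (q+3) a (q+1))
    (Seq (Const (q+5) 0)
    (Seq (Const (q+6) 0)
    (Seq (Op And (q+2) l l)
         (While (q+2) (lcs_inner_body q d b))))))"

text \<open>The row is cleared first because an earlier call may have left other values in array
  \<open>d\<close>; zeros are the correct row for the empty suffix. For strings of length 0 the
  initial value of \<open>q+6\<close> is already the answer.\<close>

definition lcs_prog :: "nat \<Rightarrow> nat \<Rightarrow> nat \<Rightarrow> nat \<Rightarrow> nat \<Rightarrow> nat \<Rightarrow> com" where
  "lcs_prog q d r a b l =
     Seq (Const q 1)
    (Seq (Const (q+6) 0)
    (Seq (Op And (q+2) l l)
    (Seq (While (q+2) (lcs_clear_body q d))
    (Seq (Op And (q+1) l l)
    (Seq (While (q+1) (lcs_outer_body q d a b l))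
         (Op And r (q+6) (q+6)))))))"

text \<open>\<open>R0\<close> and \<open>M0\<close> are the contents at the moment of the query.
  Scratch space lies above \<open>l\<close>, \<open>a\<close> and \<open>b\<close>, so the strings
  stay intact; \<open>0 < w\<close> ensures that the constant 1 is a word.\<close>

locale lcs_machine =
  fixes w q d a b l :: nat and R0 :: "nat \<Rightarrow> nat" and M0 :: "nat \<Rightarrow> nat \<Rightarrow> nat"
  assumes w: "0 < w" and fresh: "l < q" "a < d" "b < d" and word: "R0 l < 2 ^ w"
begin

abbreviation "N \<equiv> R0 l"

definition L :: "nat \<Rightarrow> nat \<Rightarrow> nat" where
  "L i j = lcs_length (map (M0 a) [i..<N]) (map (M0 b) [j..<N])"

lemma L_end [simp]: "L N j = 0" "L i N = 0"
  by (simp_all add: L_def)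

lemma L_rec:
  assumes "i < N" "j < N"
  shows "L i j = (if M0 a i = M0 b j then L (Suc i) (Suc j) + 1
                  else max (L i (Suc j)) (L (Suc i) j))"
  using assms by (simp add: L_def upt_conv_Cons lcs_length_Cons_same lcs_length_Cons_diff max.commute)

lemma L_le: "L i j \<le> N - i"
  using lcs_length_le[of "map (M0 a) [i..<N]"] by (simp add: L_def)

text \<open>Table entries are words, so storing them in registers never wraps around.\<close>

lemma L_less: "L i j < 2 ^ w"
  using L_le[of i j] word by linarith

lemma length_reg_not_scratch [simp]: "l \<noteq> q" "l \<noteq> Suc q" "l \<noteq> Suc (Suc q)" "l \<noteq> q + k"
  using fresh by auto

lemma mod_word: "i < N \<Longrightarrow> i mod 2 ^ w = i"
  using word by simp

definition frame :: "(nat \<Rightarrow> nat) \<Rightarrow> (nat \<Rightarrow> nat \<Rightarrow> nat) \<Rightarrow> bool" where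
  "frame R M \<longleftrightarrow> (\<forall>x<q. R x = R0 x) \<and> (\<forall>x<d. M x = M0 x) \<and> R q = 1"

lemma frame_simps:
  assumes "frame R M"
  shows "R q = Suc 0" "R l = N" "M a = M0 a" "M b = M0 b"
  using assms fresh by (auto simp: frame_def)

lemma frame_upd [simp]:
  "q < x \<Longrightarrow> frame (R(x := v)) M = frame R M"
  "frame R (M(d := z)) = frame R M"
  by (auto simp: frame_def)

section \<open>Loop invariants and step counts\<close>

definition clear_inv :: "nat \<Rightarrow> (nat \<Rightarrow> nat) \<Rightarrow> (nat \<Rightarrow> nat \<Rightarrow> nat) \<Rightarrow> bool" where
  "clear_inv j R M \<longleftrightarrow> frame R M \<and> R (q+2) = j \<and> R (q+6) = 0 \<and> (\<forall>k. j \<le> k \<and> k < N \<longrightarrow> M d k = 0)"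

text \<open>Counter value \<open>j\<close> means that the columns from \<open>j\<close> on are done:
  their cells belong to row \<open>i\<close>, while the cells below \<open>j\<close> still belong to
  row \<open>i + 1\<close>.\<close>

definition inner_inv :: "nat \<Rightarrow> nat \<Rightarrow> (nat \<Rightarrow> nat) \<Rightarrow> (nat \<Rightarrow> nat \<Rightarrow> nat) \<Rightarrow> bool" where
  "inner_inv i j R M \<longleftrightarrow> frame R M \<and> R (q+1) = i \<and> R (q+2) = j \<and> R (q+3) = M0 a i \<and>
     R (q+5) = L (Suc i) j \<and> R (q+6) = L i j \<and>
     (\<forall>k<N. M d k = (if k < j then L (Suc i) k else L i k))"

definition outer_inv :: "nat \<Rightarrow> (nat \<Rightarrow> nat) \<Rightarrow> (nat \<Rightarrow> nat \<Rightarrow> nat) \<Rightarrow> bool" where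
  "outer_inv i R M \<longleftrightarrow> frame R M \<and> R (q+1) = i \<and> R (q+6) = L i 0 \<and> (\<forall>k<N. M d k = L i k)"

lemma clear_step:
  assumes "j < N" "clear_inv (Suc j) R M"
  shows "R (q+2) \<noteq> 0 \<and> wp w (lcs_clear_body q d) (R, M)
           (\<lambda>t s. t \<le> 2 \<and> (case s of (R', M') \<Rightarrow> clear_inv j R' M'))"
  using assms by (auto simp: clear_inv_def lcs_clear_body_def frame_simps mod_word)

lemma inner_step:
  assumes "i < N" "j < N" "inner_inv i (Suc j) R M"
  shows "R (q+2) \<noteq> 0 \<and> wp w (lcs_inner_body q d b) (R, M)
           (\<lambda>t s. t \<le> 10 \<and> (case s of (R', M') \<Rightarrow> inner_inv i j R' M'))"
proof -
  have inv: "frame R M" "R (q+1) = i" "R (q+2) = Suc j" "R (q+3) = M0 a i"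
    "R (q+5) = L (Suc i) (Suc j)" "R (q+6) = L i (Suc j)"
    "\<And>k. k < N \<Longrightarrow> M d k = (if k < Suc j then L (Suc i) k else L i k)"
    using assms(3) by (auto simp: inner_inv_def)
  have Mdj: "M d j = L (Suc i) j" using inv(7)[of j] assms(2) by simp
  have row: "M d k = (if k < j then L (Suc i) k else L i k)" if "k < N" "k \<noteq> j" for k
    using inv(7)[of k] that by auto
  note S = inv(2-6) Mdj frame_simps[OF inv(1)] mod_word[OF assms(2)]
  \<comment> \<open>The three cases of the recurrence are the three paths through the loop body. The
    longest takes 10 steps: four before the conditional, at most four in it, two after it.\<close>
  consider "M0 a i = M0 b j" "L i j = Suc (L (Suc i) (Suc j))"
    | "M0 a i \<noteq> M0 b j" "L i (Suc j) < L (Suc i) j" "L i j = L (Suc i) j"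
    | "M0 a i \<noteq> M0 b j" "\<not> L i (Suc j) < L (Suc i) j" "L i j = L i (Suc j)"
    using L_rec[OF assms(1,2)] by (auto split: if_splits)
  then show ?thesis
  proof cases
    case 1
    then show ?thesis using S L_less[of i j] L_less[of "Suc i" j] inv(1) w
      by (simp add: lcs_inner_body_def inner_inv_def row)
  next
    case 2
    then show ?thesis using S L_less[of "Suc i" j] inv(1) w
      by (simp add: lcs_inner_body_def inner_inv_def row)
  next
    case 3
    then show ?thesis using S L_less[of "Suc i" j] inv(1) w
      by (simp add: lcs_inner_body_def inner_inv_def row)
  qed
qed

text \<open>Five assignments precede the inner loop, which takes at most \<open>11 * N + 1\<close>
  steps. Initially its counter is \<open>N\<close>, where the row is untouched and both carried
  entries are 0.\<close>

lemma outer_step: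
  assumes "i < N" "outer_inv (Suc i) R M"
  shows "R (q+1) \<noteq> 0 \<and> wp w (lcs_outer_body q d a b l) (R, M)
           (\<lambda>t s. t \<le> 11 * N + 6 \<and> (case s of (R', M') \<Rightarrow> outer_inv i R' M'))"
  using assms word
  apply (clarsimp simp: outer_inv_def lcs_outer_body_def frame_simps mod_word)
  apply (rule wp_While[where Inv = "inner_inv i" and n = N and K = 10])
     apply (use inner_step in simp)
  subgoal by (simp add: inner_inv_def)
  subgoal using fresh by (simp add: inner_inv_def frame_simps)
  subgoal by (simp add: inner_inv_def outer_inv_def)
  done

text \<open>Clearing takes at most \<open>3 * N + 1\<close> steps, the outer loop at most
  \<open>(11 * N + 7) * N + 1\<close>, and there are five further assignments.\<close>

lemma lcs_prog_correct:
  assumes "r < q" "\<forall>x<q. R x = R0 x" "\<forall>x<d. M x = M0 x"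
  shows "wp w (lcs_prog q d r a b l) (R, M)
           (\<lambda>t s. t \<le> 11 * N * N + 10 * N + 7 \<and> (case s of (R', M') \<Rightarrow>
              (\<forall>x<q. R' x = (R0(r := L 0 0)) x) \<and> (\<forall>x<d. M' x = M0 x)))"
  using assms word fresh w
  apply (clarsimp simp: lcs_prog_def)
  apply (rule wp_While[where Inv = clear_inv and n = N and K = 2])
     apply (use clear_step in simp)
  subgoal by (simp add: clear_inv_def)
  subgoal by (simp add: clear_inv_def frame_def)
  apply (clarsimp simp: clear_inv_def frame_simps)
  apply (rule wp_While[where Inv = outer_inv and n = N and K = "11 * N + 6"])
     apply (use outer_step in simp)
  subgoal by (simp add: outer_inv_def)
  subgoal by (simp add: outer_inv_def frame_simps)
  subgoal using L_less[of 0 0] by (auto simp: outer_inv_def frame_def algebra_simps)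
  done

end

subsection \<open>Replacing the oracle\<close>

fun regs :: "com \<Rightarrow> nat set" where
  "regs Skip = {}"
| "regs (Const r v) = {r}"
| "regs (Op f r x y) = {r, x, y}"
| "regs (Load r a i) = {r, i}"
| "regs (Store a i r) = {i, r}"
| "regs (Query r a b l) = {r, l}"
| "regs (Seq p p') = regs p \<union> regs p'"
| "regs (Cond r p p') = insert r (regs p \<union> regs p')"
| "regs (While r p) = insert r (regs p)"

fun arrays :: "com \<Rightarrow> nat set" where
  "arrays (Load r a i) = {a}"
| "arrays (Store a i r) = {a}"
| "arrays (Query r a b l) = {a, b}"
| "arrays (Seq p p') = arrays p \<union> arrays p'"
| "arrays (Cond r p p') = arrays p \<union> arrays p'"
| "arrays (While r p) = arrays p"
| "arrays _ = {}"

lemma finite_regs: "finite (regs p)" and finite_arrays: "finite (arrays p)"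
  by (induction p) auto

fun answer_queries :: "nat \<Rightarrow> nat \<Rightarrow> com \<Rightarrow> com" where
  "answer_queries q d (Query r a b l) = lcs_prog q d r a b l"
| "answer_queries q d (Seq p p') = Seq (answer_queries q d p) (answer_queries q d p')"
| "answer_queries q d (Cond r p p') = Cond r (answer_queries q d p) (answer_queries q d p')"
| "answer_queries q d (While r p) = While r (answer_queries q d p)"
| "answer_queries q d p = p"

lemma query_free_answer_queries: "query_free (answer_queries q d p)"
  by (induction p)
    (auto simp: lcs_prog_def lcs_clear_body_def lcs_outer_body_def lcs_inner_body_def)

section \<open>Simulation of runs with queries by query-free runs\<close>

definition words :: "nat \<Rightarrow> state \<Rightarrow> bool" where
  "words w s \<longleftrightarrow> (\<forall>x. fst s x < 2 ^ w) \<and> (\<forall>a i. snd s a i < 2 ^ w)"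

text \<open>Scratch registers and arrays are left unconstrained, so the second state may keep
  remains of earlier calls.\<close>

definition agree :: "nat \<Rightarrow> nat \<Rightarrow> state \<Rightarrow> state \<Rightarrow> bool" where
  "agree q d s u \<longleftrightarrow> (\<forall>x<q. fst u x = fst s x) \<and> (\<forall>a<d. snd u a = snd s a)"

lemma op_val_less: "op_val w f x y < 2 ^ w"
  by (cases f) simp_all

text \<open>An answer is at most the length queried, hence again a word. The bound on query sizes
  serves twice: the dynamic program can index its strings, and \<open>log N\<close> is at most
  \<open>w\<close>.\<close>

lemma exec_words:
  "exec w p s t Ns s' \<Longrightarrow> words w s \<Longrightarrow> words w s' \<and> (\<forall>N\<in>set Ns. N < 2 ^ w)"
proof (induction rule: exec.induct)
  case (Query r a b l R M)
  have "lcs_length (map (M a) [0..<R l]) (map (M b) [0..<R l]) \<le> R l"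
    using lcs_length_le[of "map (M a) [0..<R l]" "map (M b) [0..<R l]"] by simp
  also have "\<dots> < 2 ^ w" using Query by (simp add: words_def)
  finally show ?case using Query by (simp add: words_def)
next
  case (Op f r x y R M)
  then show ?case using op_val_less by (simp add: words_def)
next
  case (Const r v R M)
  then show ?case by (simp add: words_def)
next
  case (Load r a i R M)
  then show ?case by (simp add: words_def)
next
  case (Store a i r R M)
  then show ?case by (simp add: words_def)
qed auto

lemma wp_answer_queries:
  assumes "exec w p s t Ns s'" "0 < w" "words w s" "agree q d s u"
    and "regs p \<subseteq> {..<q}" "arrays p \<subseteq> {..<d}"
  shows "wp w (answer_queries q d p) u
           (\<lambda>t' u'. t' \<le> 21 * (t + (\<Sum>N\<leftarrow>Ns. N\<^sup>2)) \<and> agree q d s' u')"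
  using assms
proof (induction arbitrary: u rule: exec.induct)
  case (Skip s)
  then show ?case by (cases u) simp
next
  case (Const r v R M)
  then show ?case by (cases u) (auto simp: agree_def)
next
  case (Op f r x y R M)
  then show ?case by (cases u) (auto simp: agree_def)
next
  case (Load r a i R M)
  then show ?case by (cases u) (auto simp: agree_def)
next
  case (Store a i r R M)
  then show ?case by (cases u) (auto simp: agree_def)
next
  case (Query r a b l R M)
  obtain R' M' where u: "u = (R', M')" by (cases u)
  interpret lcs_machine w q d a b l R M
    using Query by unfold_locales (auto simp: words_def)
  have "N \<le> N * N" by (cases N) auto
  \<comment> \<open>The factor 21 is 11 + 10, as the linear term is absorbed by the square; a query
    is charged its own step plus \<open>N * N\<close>.\<close>
  moreover have "11 * x + 10 * y + 7 \<le> 21 * (1 + x)" if "y \<le> x" for x y :: nat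
    using that by simp
  ultimately have "11 * N * N + 10 * N + 7 \<le> 21 * (1 + N\<^sup>2)"
    unfolding power2_eq_square mult.assoc by blast
  then show ?case
    using Query.prems lcs_prog_correct[of r R' M']
    by (auto simp: u agree_def L_def elim!: wp_mono)
next
  case (Seq p s t Ns s' p' t' Ns' s'')
  have words: "words w s'" using exec_words Seq.hyps(1) Seq.prems by blast
  have "wp w (answer_queries q d p) u
      (\<lambda>k u'. k \<le> 21 * (t + (\<Sum>N\<leftarrow>Ns. N\<^sup>2)) \<and> agree q d s' u')"
    using Seq.IH(1)[of u] Seq.prems by simp
  then show ?case
    unfolding answer_queries.simps wp_Seq
  proof (rule wp_mono)
    fix k u'
    assume k: "k \<le> 21 * (t + (\<Sum>N\<leftarrow>Ns. N\<^sup>2)) \<and> agree q d s' u'"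
    then have "wp w (answer_queries q d p') u'
        (\<lambda>k u'. k \<le> 21 * (t' + (\<Sum>N\<leftarrow>Ns'. N\<^sup>2)) \<and> agree q d s'' u')"
      using Seq.IH(2)[of u'] Seq.prems words by simp
    then show "wp w (answer_queries q d p') u'
        (\<lambda>k' u'. k + k' \<le> 21 * (t + t' + (\<Sum>N\<leftarrow>Ns @ Ns'. N\<^sup>2)) \<and> agree q d s'' u')"
      by (rule wp_mono) (use k in simp)
  qed
next
  case (CondTrue R r p M t Ns s' p')
  obtain R' M' where u: "u = (R', M')" by (cases u)
  have r: "R' r = R r" using CondTrue.prems by (simp add: u agree_def)
  have "wp w (answer_queries q d p) u
      (\<lambda>k u'. k \<le> 21 * (t + (\<Sum>N\<leftarrow>Ns. N\<^sup>2)) \<and> agree q d s' u')"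
    using CondTrue.IH[of u] CondTrue.prems by simp
  then have "wp w (answer_queries q d p) (R', M')
      (\<lambda>k u'. k + 1 \<le> 21 * (t + 1 + (\<Sum>N\<leftarrow>Ns. N\<^sup>2)) \<and> agree q d s' u')"
    unfolding u by (rule wp_mono) simp
  then show ?case
    unfolding u answer_queries.simps wp_Cond r using CondTrue.hyps(1) by (simp only: simp_thms if_True)
next
  case (CondFalse R r p' M t Ns s' p)
  obtain R' M' where u: "u = (R', M')" by (cases u)
  have r: "R' r = R r" using CondFalse.prems by (simp add: u agree_def)
  have "wp w (answer_queries q d p') u
      (\<lambda>k u'. k \<le> 21 * (t + (\<Sum>N\<leftarrow>Ns. N\<^sup>2)) \<and> agree q d s' u')"
    using CondFalse.IH[of u] CondFalse.prems by simp
  then have "wp w (answer_queries q d p') (R', M')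
      (\<lambda>k u'. k + 1 \<le> 21 * (t + 1 + (\<Sum>N\<leftarrow>Ns. N\<^sup>2)) \<and> agree q d s' u')"
    unfolding u by (rule wp_mono) simp
  then show ?case
    unfolding u answer_queries.simps wp_Cond r using CondFalse.hyps(1) by (simp only: simp_thms if_False)
next
  case (WhileFalse R r p M)
  obtain R' M' where u: "u = (R', M')" by (cases u)
  have "R' r = 0" using WhileFalse by (simp add: u agree_def)
  then have "exec w (While r (answer_queries q d p)) u 1 [] u"
    unfolding u by (rule exec.WhileFalse)
  then show ?case
    using WhileFalse.prems(3) unfolding answer_queries.simps wp_def
    by (intro exI[of _ 1] exI[of _ u]) simp
next
  case (WhileTrue R r p M t Ns s' t' Ns' s'')
  have "words w s'" using exec_words WhileTrue.hyps(2) WhileTrue.prems by blast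
  obtain R' M' where u: "u = (R', M')" by (cases u)
  have nz: "R' r \<noteq> 0" using WhileTrue.prems WhileTrue.hyps(1) by (auto simp: u agree_def)
  \<comment> \<open>No iteration count is available for \<open>wp_While\<close>; the loop is
    unrolled along the given run instead.\<close>
  obtain k u1 where 1: "exec w (answer_queries q d p) u k [] u1"
      "k \<le> 21 * (t + (\<Sum>N\<leftarrow>Ns. N\<^sup>2))" "agree q d s' u1"
    using WhileTrue.IH(1)[of u] WhileTrue.prems unfolding wp_def by auto
  obtain k' u2 where 2: "exec w (While r (answer_queries q d p)) u1 k' [] u2"
      "k' \<le> 21 * (t' + (\<Sum>N\<leftarrow>Ns'. N\<^sup>2))" "agree q d s'' u2"
    using WhileTrue.IH(2)[of u1] WhileTrue.prems \<open>words w s'\<close> 1(3) unfolding wp_def by auto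
  have "exec w (While r (answer_queries q d p)) u (k + k' + 1) [] u2"
    using exec.WhileTrue[of R' r, OF nz 1(1)[unfolded u] 2(1)] by (simp add: u)
  moreover have "k + k' + 1 \<le> 21 * (t + t' + 1 + (\<Sum>N\<leftarrow>Ns @ Ns'. N\<^sup>2))"
    using 1(2) 2(2) by simp
  ultimately show ?case using 2(3) unfolding wp_def answer_queries.simps by blast
qed

lemma words_init_state:
  assumes "input_fits \<gamma> n \<phi>"
  shows "words (word_size \<gamma> n (length \<phi>)) (init_state (encode n \<phi>))"
proof -
  have "xs ! i < 2 ^ w" if "\<forall>x\<in>set xs. x < 2 ^ w" "i < length xs" for xs :: "nat list" and i w
    using that by simp
  then show ?thesis
    using assms unfolding input_fits_def Let_def words_def init_state_def by simp
qed

text \<open>With words of 0 bits the input would have to be empty, but every encoding starts with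
  two numbers.\<close>

lemma input_fits_word_size_pos:
  assumes "input_fits \<gamma> n \<phi>"
  shows "0 < word_size \<gamma> n (length \<phi>)"
proof (rule ccontr)
  assume "\<not> ?thesis"
  then have "word_size \<gamma> n (length \<phi>) = 0" by blast
  then have "length (encode n \<phi>) < 2 ^ 0" using assms unfolding input_fits_def Let_def by metis
  then show False by (simp add: encode_def)
qed

lemma oracle_free_simulation:
  obtains X' where "query_free X'"
    and "\<And>\<gamma> n \<phi> t Ns. input_fits \<gamma> n \<phi> \<Longrightarrow> correct_run X \<gamma> n \<phi> t Ns \<Longrightarrow>
       (\<exists>t'\<le>21 * (t + (\<Sum>N\<leftarrow>Ns. N\<^sup>2)). correct_run X' \<gamma> n \<phi> t' []) \<and>
       (\<forall>N\<in>set Ns. N < 2 ^ word_size \<gamma> n (length \<phi>))"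
proof -
  \<comment> \<open>Register 0 is included because the verdict is read there even if
    \<open>X\<close> never mentions it.\<close>
  obtain q where q: "insert 0 (regs X) \<subseteq> {..<q}"
    using finite_nat_bounded[OF finite.insertI[OF finite_regs]] by blast
  obtain d where d: "arrays X \<subseteq> {..<d}"
    using finite_nat_bounded[OF finite_arrays] by blast
  show ?thesis
  proof
    show "query_free (answer_queries q d X)" by (rule query_free_answer_queries)
  next
    fix \<gamma> n \<phi> t Ns
    assume fits: "input_fits \<gamma> n \<phi>" and run: "correct_run X \<gamma> n \<phi> t Ns"
    define w where "w = word_size \<gamma> n (length \<phi>)"
    define s where "s = init_state (encode n \<phi>)"
    obtain R M where ex: "exec w X s t Ns (R, M)" and R: "R 0 \<noteq> 0 \<longleftrightarrow> satisfiable \<phi>"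
      using run unfolding correct_run_def w_def s_def by auto
    have "words w s" unfolding w_def s_def by (rule words_init_state[OF fits])
    moreover have "0 < w" unfolding w_def by (rule input_fits_word_size_pos[OF fits])
    moreover have "agree q d s s" by (simp add: agree_def)
    ultimately have "wp w (answer_queries q d X) s
        (\<lambda>t' u'. t' \<le> 21 * (t + (\<Sum>N\<leftarrow>Ns. N\<^sup>2)) \<and> agree q d (R, M) u')"
      using wp_answer_queries[OF ex] q d by simp
    then obtain t' u' where ex': "exec w (answer_queries q d X) s t' [] u'"
      "t' \<le> 21 * (t + (\<Sum>N\<leftarrow>Ns. N\<^sup>2))" "agree q d (R, M) u'"
      unfolding wp_def by blast
    obtain R' M' where u': "u' = (R', M')" by (cases u')
    have "R' 0 = R 0" using ex'(3) q by (simp add: agree_def u')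
    then have "correct_run (answer_queries q d X) \<gamma> n \<phi> t' []"
      using R ex'(1) unfolding correct_run_def w_def s_def u' by metis
    then show "(\<exists>t'\<le>21 * (t + (\<Sum>N\<leftarrow>Ns. N\<^sup>2)). correct_run (answer_queries q d X) \<gamma> n \<phi> t' []) \<and>
       (\<forall>N\<in>set Ns. N < 2 ^ word_size \<gamma> n (length \<phi>))"
      using ex'(2) exec_words[OF ex \<open>words w s\<close>] unfolding w_def by blast
  qed
qed

subsection \<open>Absorbing the logarithms\<close>

lemma word_size_le: "real (word_size \<gamma> n m) \<le> 2 * real \<gamma> * (real n + real m + 1)"
proof -
  have "log 2 (real m + 2) \<le> real m + 1"
  proof -
    \<comment> \<open>This crude linear bound on the logarithm is enough, since polynomial factors
      are free.\<close>
    have "Suc m < 2 ^ Suc m" by (rule less_exp)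
    then have "real m + 2 \<le> 2 ^ Suc m"
      by (metis Suc_leI add_2_eq_Suc' of_nat_add of_nat_le_iff of_nat_numeral of_nat_power)
    then have "log 2 (real m + 2) \<le> log 2 (2 ^ Suc m)" by simp
    then show ?thesis by (simp add: log_nat_power del: power_Suc)
  qed
  then have "\<lceil>log 2 (real m + 2)\<rceil> \<le> int m + 1" by linarith
  then have "nat \<lceil>log 2 (real m + 2)\<rceil> \<le> m + 1" unfolding nat_le_iff by simp
  then have "n + nat \<lceil>log 2 (real m + 2)\<rceil> \<le> 2 * (n + m + 1)" by simp
  then have "real (n + nat \<lceil>log 2 (real m + 2)\<rceil>) \<le> real (2 * (n + m + 1))" by (rule of_nat_mono)
  then have "real (n + nat \<lceil>log 2 (real m + 2)\<rceil>) \<le> 2 * (real n + real m + 1)" by simp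
  then have "real \<gamma> * real (n + nat \<lceil>log 2 (real m + 2)\<rceil>) \<le> real \<gamma> * (2 * (real n + real m + 1))"
    by (rule mult_left_mono) simp
  then show ?thesis by (simp only: word_size_def of_nat_mult mult.left_commute mult.assoc)
qed

text \<open>The logarithm \<open>l\<close> in \<open>lcs_time\<close> satisfies
  \<open>1 <= l <= w\<close>: the maximum with 2 gives the lower bound, \<open>N < 2 ^ w\<close> the
  upper one. So the division by \<open>l powr c\<close> is undone by
  \<open>w powr c\<close>.\<close>

lemma square_le_lcs_time:
  assumes "N < 2 ^ w" "0 < w" "0 < c"
  shows "(real N)\<^sup>2 \<le> real w powr c * lcs_time c N"
proof -
  define l where "l = log 2 (real (max 2 N))"
  have "max 2 N \<le> 2 ^ w" using assms(1,2) by (simp add: self_le_power)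
  then have "real (max 2 N) \<le> 2 ^ w"
    by (metis of_nat_le_iff of_nat_numeral of_nat_power)
  then have "l \<le> log 2 (2 ^ w)" unfolding l_def by (subst log_le_cancel_iff) auto
  then have "l \<le> real w" by (simp add: log_nat_power)
  moreover have "1 \<le> l" unfolding l_def by (subst one_le_log_cancel_iff) auto
  ultimately have "0 < l powr c" "l powr c \<le> real w powr c"
    using assms(3) by (auto intro: powr_mono2)
  then show ?thesis
    using mult_right_mono[of "l powr c" "real w powr c" "(real N)\<^sup>2"]
    by (simp add: lcs_time_def l_def[symmetric] field_simps)
qed

theorem theorem3p1:
  fixes c \<epsilon> :: real
  assumes "c > 0" and "\<epsilon> > 0"
    and "\<forall>k\<ge>2. ksat_to_lcs_reduction k \<epsilon> c"
  shows "\<not> SETH"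
proof -
  \<comment> \<open>Capping at 1 keeps the exponent \<open>1 - \<delta>\<close> nonnegative, so that
    the final time bound is non-decreasing in \<open>n\<close>.\<close>
  define \<delta> where "\<delta> = min \<epsilon> 1"
  have \<delta>: "0 < \<delta>" "\<delta> \<le> 1" "\<delta> \<le> \<epsilon>" using assms(2) by (auto simp: \<delta>_def)
  have "\<exists>T. running_time T \<and> T \<in> poly_times (\<lambda>n. 2 powr ((1 - \<delta>) * real n)) \<and>
      ksat_solvable_in k T" if k: "k \<ge> 2" for k
  proof -
    obtain X \<gamma> T B where B: "B \<in> poly_times (\<lambda>n. 2 ^ n / 2 powr (\<epsilon> * real n))"
      and red: "\<forall>n \<phi>. is_kcnf k n \<phi> \<longrightarrow> input_fits \<gamma> n \<phi> \<and>
          (\<exists>t Ns. correct_run X \<gamma> n \<phi> t Ns \<and> real t \<le> T n (length \<phi>) \<and>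
             T n (length \<phi>) + (\<Sum>N\<leftarrow>Ns. lcs_time c N) \<le> B n (length \<phi>))"
      using assms(3)[rule_format, OF k] unfolding ksat_to_lcs_reduction_def by blast
    obtain C d where C: "\<And>n m. B n m \<le> C * (real n + real m + 1) ^ d * (2 ^ n / 2 powr (\<epsilon> * real n))"
      using B unfolding poly_times_def by blast
    obtain X' where X': "query_free X'" and sim: "\<And>\<gamma> n \<phi> t Ns. input_fits \<gamma> n \<phi> \<Longrightarrow>
       correct_run X \<gamma> n \<phi> t Ns \<Longrightarrow>
       (\<exists>t'\<le>21 * (t + (\<Sum>N\<leftarrow>Ns. N\<^sup>2)). correct_run X' \<gamma> n \<phi> t' []) \<and>
       (\<forall>N\<in>set Ns. N < 2 ^ word_size \<gamma> n (length \<phi>))"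
      by (rule oracle_free_simulation[of X]) blast
    define e where "e = nat \<lceil>c\<rceil>"
    \<comment> \<open>The factors come from the simulation, from bounding the word size by
      \<open>(2 * \<gamma> + 1) * p\<close> for \<open>p = n + m + 1\<close>, and from the bound on
      \<open>B\<close>; the absolute value makes \<open>A\<close> nonnegative.\<close>
    define A where "A = 21 * (2 * real \<gamma> + 1) ^ e * \<bar>C\<bar>"
    \<comment> \<open>An explicit formula is taken because nothing is known about the monotonicity
      of \<open>B\<close>.\<close>
    define U where "U n m = A * (real n + real m + 1) ^ (e + d) * 2 powr ((1 - \<delta>) * real n)" for n m
    have "running_time U"
      unfolding running_time_def U_def
    proof safe
      fix n n' m m' :: nat assume "n \<le> n'" "m \<le> m'"
      then show "A * (real n + real m + 1) ^ (e + d) * 2 powr ((1 - \<delta>) * real n) \<le>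
          A * (real n' + real m' + 1) ^ (e + d) * 2 powr ((1 - \<delta>) * real n')"
        using \<delta> by (intro mult_mono power_mono powr_mono mult_left_mono) (auto simp: A_def)
    qed
    moreover have "U \<in> poly_times (\<lambda>n. 2 powr ((1 - \<delta>) * real n))"
      unfolding poly_times_def U_def by blast
    moreover have "\<exists>t'. correct_run X' \<gamma> n \<phi> t' [] \<and> real t' \<le> U n (length \<phi>)"
      if kcnf: "is_kcnf k n \<phi>" for n \<phi>
    proof -
      define m where "m = length \<phi>"
      define w where "w = word_size \<gamma> n m"
      define p where "p = real n + real m + 1"
      have p: "1 \<le> p" by (simp add: p_def)
      obtain t Ns where fits: "input_fits \<gamma> n \<phi>" and run: "correct_run X \<gamma> n \<phi> t Ns"
        and t: "real t \<le> T n m" "T n m + (\<Sum>N\<leftarrow>Ns. lcs_time c N) \<le> B n m"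
        using red kcnf unfolding m_def by blast
      obtain t' where t': "t' \<le> 21 * (t + (\<Sum>N\<leftarrow>Ns. N\<^sup>2))" "correct_run X' \<gamma> n \<phi> t' []"
        and Ns: "\<forall>N\<in>set Ns. N < 2 ^ w"
        using sim[OF fits run] unfolding w_def m_def by blast
      have w0: "0 < w" unfolding w_def m_def by (rule input_fits_word_size_pos[OF fits])
      define W where "W = real w powr c"
      have W1: "1 \<le> W" using w0 assms(1) by (simp add: W_def ge_one_powr_ge_zero)
      have "W \<le> real w powr real e"
        unfolding W_def by (rule powr_mono) (use w0 assms(1) in \<open>auto simp: e_def\<close>)
      also have "\<dots> = real w ^ e" using w0 by (simp add: powr_realpow)
      also have "\<dots> \<le> ((2 * real \<gamma> + 1) * p) ^ e"
      proof (rule power_mono)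
        have "real w \<le> 2 * real \<gamma> * p" unfolding w_def p_def by (rule word_size_le)
        also have "\<dots> \<le> (2 * real \<gamma> + 1) * p" using p by (intro mult_right_mono) auto
        finally show "real w \<le> (2 * real \<gamma> + 1) * p" .
      qed simp
      finally have W2: "W \<le> (2 * real \<gamma> + 1) ^ e * p ^ e" by (simp add: power_mult_distrib)
      have "real (\<Sum>N\<leftarrow>Ns. N\<^sup>2) = (\<Sum>N\<leftarrow>Ns. (real N)\<^sup>2)"
        by (induction Ns) auto
      also have "\<dots> \<le> (\<Sum>N\<leftarrow>Ns. W * lcs_time c N)"
        unfolding W_def using Ns w0 assms(1) by (intro sum_list_mono square_le_lcs_time) auto
      also have "\<dots> = W * (\<Sum>N\<leftarrow>Ns. lcs_time c N)" by (simp add: sum_list_const_mult)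
      finally have S: "real (\<Sum>N\<leftarrow>Ns. N\<^sup>2) \<le> W * (\<Sum>N\<leftarrow>Ns. lcs_time c N)" .
      have "real t' \<le> 21 * (real t + real (\<Sum>N\<leftarrow>Ns. N\<^sup>2))"
        using of_nat_mono[OF t'(1), where 'a = real] by simp
      \<comment> \<open>As \<open>W\<close> is at least 1, the time outside the queries may be
        inflated by \<open>W\<close> too; the whole budget \<open>B\<close> then factors
        out.\<close>
      also have "\<dots> \<le> 21 * (W * T n m + W * (\<Sum>N\<leftarrow>Ns. lcs_time c N))"
        using S t(1) mult_mono[of 1 W "real t" "T n m"] W1 by simp
      also have "\<dots> = 21 * (W * (T n m + (\<Sum>N\<leftarrow>Ns. lcs_time c N)))"
        by (simp add: algebra_simps)
      also have "\<dots> \<le> 21 * (W * B n m)"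
        using t(2) W1 by simp
      also have "B n m \<le> \<bar>C\<bar> * p ^ d * 2 powr ((1 - \<delta>) * real n)"
      proof -
        have "2 ^ n / 2 powr (\<epsilon> * real n) = 2 powr ((1 - \<epsilon>) * real n)"
          by (simp add: left_diff_distrib powr_diff powr_realpow)
        also have "\<dots> \<le> 2 powr ((1 - \<delta>) * real n)"
          using \<delta> by (intro powr_mono mult_right_mono) auto
        finally have "C * p ^ d * (2 ^ n / 2 powr (\<epsilon> * real n)) \<le>
            \<bar>C\<bar> * p ^ d * 2 powr ((1 - \<delta>) * real n)"
          using p by (intro mult_mono) auto
        then show ?thesis using C[of n m] unfolding p_def by linarith
      qed
      also have "21 * (W * (\<bar>C\<bar> * p ^ d * 2 powr ((1 - \<delta>) * real n))) \<le>
          21 * (((2 * real \<gamma> + 1) ^ e * p ^ e) * (\<bar>C\<bar> * p ^ d * 2 powr ((1 - \<delta>) * real n)))"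
        using W2 p by (intro mult_left_mono mult_right_mono) auto
      also have "\<dots> = U n m" by (simp add: U_def A_def p_def power_add)
      finally show ?thesis
        using W1 t'(2) unfolding m_def by auto
    qed
    ultimately show ?thesis
      unfolding ksat_solvable_in_def using X' red by blast
  qed
  \<comment> \<open>The same \<delta> works for every \<open>k\<close>, whereas SETH would provide a
    hard \<open>k\<close> for this \<delta>.\<close>
  then show ?thesis unfolding SETH_def using \<delta>(1) by blast
qed

end
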